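(* Let $G=(V,E)$ be a connected directed graph with edge capacities and key vertex $k\in V$, and let $i\in V\setminus\{k\}$ be a vertex such that there do not exist at least two vertex-disjoint paths starting at $i$ and ending at $k$. Let $S\subseteq V\setminus\{k\}$ be any vertex subset containing $i$, and let $T=S\setminus\{i\}$. Then $$\mathcal{L}_k(G\setminus S)\le \mathcal{L}_k(G\setminus T).$$ Therefore, $T$ has at least as large a vitality effect on $k$ as $S$, i.e. $\mathcal{L}_k(G\setminus S)-\mathcal{L}_k(G)\le \mathcal{L}_k(G\setminus T)-\mathcal{L}_k(G)$.
   Context: Let $G=(V,E)$ be a finite connected directed graph (connected: its underlying undirected graph is connected) in which each edge $(i,j)\in E$ has a nonnegative capacity $u_{ij}$, the maximum amount of flow that can be pushed along that edge. A designated vertex $k\in V$ is called the key vertex. For a set $S$ of vertices, $G\setminus S$ denotes the graph obtained from $G$ by deleting the vertices of $S$ and all their incident edges; the remaining edges keep their capacities. (Graphs obtained by deletion need not be connected.) Two paths from $i$ to $k$ are vertex-disjoint if they are distinct and share no vertices other than their endpoints $i$ and $k$. For a capacitated directed graph $H$ and distinct vertices $s,t$ of $H$, let $z_{st}(H)$ be the value of a maximum $s$-$t$ flow in $H$. With $V(H)$ the vertex set of $H$, the flow capacity of $H$ with respect to $k$ is $$Z_k(H)=\sum_{\substack{s,t\in V(H)\setminus\{k\}\\ s\ne t}} z_{st}(H),$$ the sum being over ordered pairs. If $k$ is a vertex of $H$, the all-pairs vitality of $k$ in $H$ is $$\mathcal{L}_k(H)=Z_k(H)-Z_k(H\setminus\{k\}).$$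 The vitality effect of a subset $S\subseteq V\setminus\{k\}$ on $k$ is $\mathcal{L}_k(G\setminus S)-\mathcal{L}_k(G)$.
   Formalization: Paths from i to k are taken in the underlying undirected graph; with directed paths the claim fails, e.g. for unit edges s→i, s→k, i→m, k→m, m→t with S={i}, where deleting i raises the vitality of k from 1 to 2. *)

theory Defs
  imports "HOL-Analysis.Analysis" "Graph_Theory.Graph_Theory"
begin

section \<open>Maximum flows\<close>

definition st_flow ::
  "('a, 'b) pre_digraph \<Rightarrow> ('b \<Rightarrow> real) \<Rightarrow> 'a \<Rightarrow> 'a \<Rightarrow> ('b \<Rightarrow> real) \<Rightarrow> bool" where
  "st_flow H u s t f \<longleftrightarrow>
     (\<forall>e\<in>arcs H. 0 \<le> f e \<and> f e \<le> u e) \<and>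
     (\<forall>v\<in>verts H - {s, t}. sum f (in_arcs H v) = sum f (out_arcs H v))"

definition flow_value :: "('a, 'b) pre_digraph \<Rightarrow> 'a \<Rightarrow> ('b \<Rightarrow> real) \<Rightarrow> real" where
  "flow_value H s f = sum f (out_arcs H s) - sum f (in_arcs H s)"

text \<open>The supremum is attained on finite digraphs with nonnegative capacities, see
  \<open>max_flow_value_attained\<close> below.\<close>

definition max_flow_value ::
  "('a, 'b) pre_digraph \<Rightarrow> ('b \<Rightarrow> real) \<Rightarrow> 'a \<Rightarrow> 'a \<Rightarrow> real" where
  "max_flow_value H u s t = Sup (flow_value H s ` {f. st_flow H u s t f})"

lemma max_flow_exists:
  assumes "fin_digraph H" and u: "\<And>e. e \<in> arcs H \<Longrightarrow> 0 \<le> u e"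
  shows "\<exists>f. st_flow H u s t f \<and> (\<forall>g. st_flow H u s t g \<longrightarrow> flow_value H s g \<le> flow_value H s f)"
proof -
  interpret fin_digraph H by fact
  define B where "B = (\<lambda>e. if e \<in> arcs H then {0..u e} else {0::real})"
  define C where "C = {f :: _ \<Rightarrow> real. \<forall>v\<in>verts H - {s, t}.
    sum f (in_arcs H v) = sum f (out_arcs H v)}"
  have cont: "continuous_on UNIV (\<lambda>f :: _ \<Rightarrow> real. sum f A)" for A
    by (intro continuous_intros continuous_on_product_then_coordinatewise continuous_on_id)
  have "compactin (product_topology (\<lambda>_. euclidean) UNIV) (PiE UNIV B)"
    unfolding compactin_PiE by (auto simp: B_def)
  then have "compact (PiE UNIV B)"
    by (simp add: euclidean_product_topology)
  moreover have "closed C"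
  proof -
    have "C = (\<Inter>v\<in>verts H - {s, t}. {f. sum f (in_arcs H v) = sum f (out_arcs H v)})"
      by (auto simp: C_def)
    then show ?thesis
      using closed_Collect_eq[OF cont cont] by auto
  qed
  ultimately have comp: "compact (PiE UNIV B \<inter> C)" by (rule compact_Int_closed)
  have "(\<lambda>_. 0) \<in> PiE UNIV B \<inter> C"
    using u by (auto simp: B_def C_def)
  then have ne: "PiE UNIV B \<inter> C \<noteq> {}" by blast
  have "continuous_on (PiE UNIV B \<inter> C) (flow_value H s)"
    unfolding flow_value_def
    by (intro continuous_on_diff continuous_on_subset[OF cont subset_UNIV])
  from continuous_attains_sup[OF comp ne this] obtain f
    where f: "f \<in> PiE UNIV B \<inter> C"
      and max: "\<And>g. g \<in> PiE UNIV B \<inter> C \<Longrightarrow> flow_value H s g \<le> flow_value H s f" by blast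
  have "f e \<in> B e" for e using f by auto
  then have "0 \<le> f e \<and> f e \<le> u e" if "e \<in> arcs H" for e
    using that unfolding B_def by (metis atLeastAtMost_iff)
  with f have "st_flow H u s t f" by (auto simp: st_flow_def C_def)
  moreover have "flow_value H s g \<le> flow_value H s f" if g: "st_flow H u s t g" for g
  proof -
    define g' where "g' = (\<lambda>e. if e \<in> arcs H then g e else 0)"
    have eq: "sum g' (in_arcs H v) = sum g (in_arcs H v)"
      "sum g' (out_arcs H v) = sum g (out_arcs H v)" for v
      by (auto simp: g'_def intro!: sum.cong)
    have "g' \<in> PiE UNIV B \<inter> C"
      using g by (auto simp: B_def C_def st_flow_def eq) (auto simp: g'_def)
    from max[OF this] show ?thesis by (simp add: flow_value_def eq)
  qed
  ultimately show ?thesis by blast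
qed

lemma max_flow_value_attained:
  assumes "fin_digraph H" and "\<And>e. e \<in> arcs H \<Longrightarrow> 0 \<le> u e"
  obtains f where "st_flow H u s t f" "flow_value H s f = max_flow_value H u s t"
    "\<And>g. st_flow H u s t g \<Longrightarrow> flow_value H s g \<le> max_flow_value H u s t"
proof -
  have "\<exists>f. st_flow H u s t f \<and>
      (\<forall>g. st_flow H u s t g \<longrightarrow> flow_value H s g \<le> flow_value H s f)"
    using assms by (rule max_flow_exists)
  then obtain f where f: "st_flow H u s t f"
    and m: "\<And>g. st_flow H u s t g \<Longrightarrow> flow_value H s g \<le> flow_value H s f" by auto
  have "max_flow_value H u s t = flow_value H s f"
    unfolding max_flow_value_def using f m by (intro cSup_eq_maximum) auto
  with f m show thesis by (intro that[of f]) auto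
qed


section \<open>All-pairs vitality\<close>

definition delete_verts :: "('a, 'b) pre_digraph \<Rightarrow> 'a set \<Rightarrow> ('a, 'b) pre_digraph" where
  "delete_verts H S = H \<restriction> (verts H - S)"

definition flow_capacity :: "('a, 'b) pre_digraph \<Rightarrow> ('b \<Rightarrow> real) \<Rightarrow> 'a \<Rightarrow> real" where
  "flow_capacity H u k =
     (\<Sum>(s, t)\<in>{(s, t). s \<in> verts H - {k} \<and> t \<in> verts H - {k} \<and> s \<noteq> t}. max_flow_value H u s t)"

definition all_pairs_vitality :: "('a, 'b) pre_digraph \<Rightarrow> ('b \<Rightarrow> real) \<Rightarrow> 'a \<Rightarrow> real" where
  "all_pairs_vitality H u k = flow_capacity H u k - flow_capacity (delete_verts H {k}) u k"

definition vitality_effect ::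
  "('a, 'b) pre_digraph \<Rightarrow> ('b \<Rightarrow> real) \<Rightarrow> 'a \<Rightarrow> 'a set \<Rightarrow> real" where
  "vitality_effect H u k S = all_pairs_vitality (delete_verts H S) u k - all_pairs_vitality H u k"


section \<open>Vertex-disjoint paths\<close>

text \<open>
  Paths are taken in the underlying undirected graph, as connectedness is; they are the simple
  paths of \<open>mk_symmetric G\<close>. Directed paths would not do: in the digraph with unit-capacity arcs
  \<open>s \<rightarrow> i\<close>, \<open>s \<rightarrow> k\<close>, \<open>i \<rightarrow> m\<close>, \<open>k \<rightarrow> m\<close>, \<open>m \<rightarrow> t\<close> there is no directed path from \<open>i\<close> to \<open>k\<close>,
  yet deleting \<open>i\<close> raises the all-pairs vitality of \<open>k\<close> from 1 to 2. A path is determined by its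
  vertex sequence, so antiparallel arcs between two vertices give only one undirected edge.
\<close>

definition undirected_path :: "('a, 'b) pre_digraph \<Rightarrow> 'a \<Rightarrow> ('a \<times> 'a) list \<Rightarrow> 'a \<Rightarrow> bool" where
  "undirected_path G i p k \<longleftrightarrow> pre_digraph.apath (with_proj (mk_symmetric G)) i p k"

definition vertex_disjoint_paths ::
  "('a, 'b) pre_digraph \<Rightarrow> 'a \<Rightarrow> 'a \<Rightarrow> ('a \<times> 'a) list \<Rightarrow> ('a \<times> 'a) list \<Rightarrow> bool" where
  "vertex_disjoint_paths G i k p q \<longleftrightarrow>
     undirected_path G i p k \<and> undirected_path G i q k \<and> p \<noteq> q \<and>
     set (pawalk_verts i p) \<inter> set (pawalk_verts i q) = {i, k}"

end

theory Submission
  imports Defs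
begin

text \<open>
  The vitality of \<open>k\<close> in a graph is a sum over ordered pairs \<open>(s, t)\<close> of losses: the maximum
  \<open>s\<close>-\<open>t\<close> flow minus what remains of it once \<open>k\<close> is deleted. Losses are nonnegative, so deleting
  \<open>i\<close> can only remove nonnegative terms, and it remains to see that no surviving term grows:
  deleting \<open>i\<close> must not increase the loss of any pair (\<open>flow_loss_mono\<close>).

  The hypothesis on \<open>i\<close> is used through the smallest nontrivial case of Menger's theorem
  (\<open>cut_vertex_or_bridge\<close>): in the underlying undirected graph, either some vertex \<open>c\<close> other than
  \<open>i\<close> and \<open>k\<close> separates \<open>i\<close> from \<open>k\<close>, or the edge between \<open>i\<close> and \<open>k\<close> is a bridge. Both kinds of
  separation persist when further vertices are deleted, which is why the set \<open>T\<close> is arbitrary.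

  A cut vertex \<open>c\<close> splits the arcs into two parts, the one containing \<open>i\<close> and the one containing
  \<open>k\<close>. If \<open>s\<close> and \<open>t\<close> lie in the same part, the maximum flow lives in this part
  (\<open>max_flow_same_side\<close>), so that either the loss is zero or \<open>i\<close> does not influence it. If \<open>c\<close> lies
  strictly between \<open>s\<close> and \<open>t\<close>, the parts are connected in series and the maximum flow is the
  minimum of the maximum flows through the two parts (\<open>max_flow_series\<close>). Deleting \<open>i\<close> lowers one
  argument of the minimum, deleting \<open>k\<close> lowers the other, and \<open>min\<close> is supermodular: for
  \<open>a' \<le> a\<close> and \<open>b' \<le> b\<close> one has \<open>min a' b - min a' b' \<le> min a b - min a b'\<close>.

  If the edge between \<open>i\<close> and \<open>k\<close> is a bridge, pairs on one side are treated in the same way, with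
  \<open>i\<close> or \<open>k\<close> in the role of \<open>c\<close>. For a pair on opposite sides nothing flows once \<open>i\<close> is gone, so
  its loss becomes zero.
\<close>

section \<open>Flows on arc sets\<close>

text \<open>
  Taking the net outflow of a vertex as the basic quantity makes loops invisible and lets
  conservation be demanded of every element of the type: a vertex incident to no arc has net flow
  zero. Maximum flows then depend on the arc set only, and deleting vertices means restricting it.
\<close>

definition net_flow :: "('a \<times> 'a) set \<Rightarrow> ('a \<times> 'a \<Rightarrow> real) \<Rightarrow> 'a \<Rightarrow> real" where
  "net_flow E f v = (\<Sum>e\<in>E. f e * (of_bool (fst e = v) - of_bool (snd e = v)))"

definition is_flow ::
  "('a \<times> 'a) set \<Rightarrow> ('a \<times> 'a \<Rightarrow> real) \<Rightarrow> 'a \<Rightarrow> 'a \<Rightarrow> ('a \<times> 'a \<Rightarrow> real) \<Rightarrow> bool" where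
  "is_flow E u s t f \<longleftrightarrow>
     (\<forall>e\<in>E. 0 \<le> f e \<and> f e \<le> u e) \<and> (\<forall>v. v \<notin> {s, t} \<longrightarrow> net_flow E f v = 0)"

definition max_flow ::
  "('a \<times> 'a) set \<Rightarrow> ('a \<times> 'a \<Rightarrow> real) \<Rightarrow> 'a \<Rightarrow> 'a \<Rightarrow> real" where
  "max_flow E u s t = Sup ((\<lambda>f. net_flow E f s) ` {f. is_flow E u s t f})"

text \<open>
  Two parts of a graph that meet in one vertex \<open>c\<close> may share the loop at \<open>c\<close>. It contributes
  nothing, hence additivity under a weaker condition than disjointness.
\<close>

lemma net_flow_Un:
  assumes "finite E1" "finite E2" "E1 \<inter> E2 \<subseteq> Id"
  shows "net_flow (E1 \<union> E2) f v = net_flow E1 f v + net_flow E2 f v"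
proof -
  have "net_flow (E1 \<inter> E2) f v = 0"
    unfolding net_flow_def using assms(3) by (intro sum.neutral) auto
  moreover have "net_flow (E1 \<union> E2) f v + net_flow (E1 \<inter> E2) f v
      = net_flow E1 f v + net_flow E2 f v"
    unfolding net_flow_def by (rule sum.union_inter[OF assms(1,2)])
  ultimately show ?thesis by simp
qed

lemma net_flow_outside: "E \<subseteq> A \<times> A \<Longrightarrow> v \<notin> A \<Longrightarrow> net_flow E f v = 0"
  unfolding net_flow_def by (intro sum.neutral) auto

lemma net_flow_scale: "net_flow E (\<lambda>e. r * f e) v = r * net_flow E f v"
  by (simp add: net_flow_def sum_distrib_left mult.assoc)

lemma sum_net_flow:
  assumes "finite A" "E \<subseteq> A \<times> A"
  shows "(\<Sum>v\<in>A. net_flow E f v) = 0"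
proof -
  have "(\<Sum>v\<in>A. of_bool (fst e = v) - of_bool (snd e = v)) = (0::real)" if "e \<in> E" for e
    using assms that by (auto simp: sum_subtractf)
  then have "(\<Sum>e\<in>E. \<Sum>v\<in>A. f e * (of_bool (fst e = v) - of_bool (snd e = v))) = 0"
    by (intro sum.neutral) (simp flip: sum_distrib_left)
  then show ?thesis unfolding net_flow_def by (subst sum.swap)
qed

lemma net_flow_source_sink:
  assumes "finite E" "s \<noteq> t" and "\<And>v. v \<notin> {s, t} \<Longrightarrow> net_flow E f v = 0"
  shows "net_flow E f t = - net_flow E f s"
proof -
  let ?A = "insert s (insert t (fst ` E \<union> snd ` E))"
  have "0 = (\<Sum>v\<in>?A. net_flow E f v)"
    using assms(1) by (intro sum_net_flow[symmetric]) force+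
  also have "\<dots> = (\<Sum>v\<in>{s, t}. net_flow E f v)"
    using assms by (intro sum.mono_neutral_right) auto
  finally show ?thesis using assms(2) by simp
qed

text \<open>
  The net flows of all vertices add up to zero, so a single vertex cannot be the only one that
  violates conservation.
\<close>

lemma net_flow_zero_of_all_but_one:
  assumes "finite E" and "\<And>v. v \<noteq> c \<Longrightarrow> net_flow E f v = 0"
  shows "net_flow E f v = 0"
proof -
  let ?A = "insert c (fst ` E \<union> snd ` E)"
  have "0 = (\<Sum>v\<in>?A. net_flow E f v)"
    using assms(1) by (intro sum_net_flow[symmetric]) force+
  also have "\<dots> = (\<Sum>v\<in>{c}. net_flow E f v)"
    using assms by (intro sum.mono_neutral_right) auto
  finally show ?thesis using assms(2) by (cases "v = c") auto
qed

lemma net_flow_conv: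
  assumes "finite (arcs H)" "tail H = fst" "head H = snd"
  shows "sum f (out_arcs H v) - sum f (in_arcs H v) = net_flow (arcs H) f v"
proof -
  have "sum f (out_arcs H v) = (\<Sum>e\<in>arcs H. f e * of_bool (fst e = v))"
    "sum f (in_arcs H v) = (\<Sum>e\<in>arcs H. f e * of_bool (snd e = v))"
    using assms by (auto intro!: sum.mono_neutral_cong_left simp: out_arcs_def in_arcs_def)
  then show ?thesis
    by (simp add: net_flow_def right_diff_distrib sum_subtractf)
qed

lemma st_flow_iff_is_flow:
  assumes "finite (arcs H)" "arcs H \<subseteq> verts H \<times> verts H" "tail H = fst" "head H = snd"
  shows "st_flow H u s t f \<longleftrightarrow> is_flow (arcs H) u s t f"
proof -
  have "sum f (in_arcs H v) = sum f (out_arcs H v) \<longleftrightarrow> net_flow (arcs H) f v = 0" for v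
    using net_flow_conv[OF assms(1,3,4), of f v] by linarith
  moreover have "net_flow (arcs H) f v = 0" if "v \<notin> verts H" for v
    by (rule net_flow_outside[OF assms(2) that])
  ultimately show ?thesis unfolding st_flow_def is_flow_def by blast
qed

lemma max_flow_value_eq_max_flow:
  assumes "finite (arcs H)" "arcs H \<subseteq> verts H \<times> verts H" "tail H = fst" "head H = snd"
  shows "max_flow_value H u s t = max_flow (arcs H) u s t"
  using net_flow_conv[OF assms(1,3,4)] st_flow_iff_is_flow[OF assms]
  by (simp add: max_flow_value_def max_flow_def flow_value_def)

text \<open>
  Maximality transfers from digraphs to arc sets by taking the digraph whose vertices are the
  endpoints of the arcs.
\<close>

lemma max_flow_is_maximum:
  assumes "finite E" and "\<forall>e\<in>E. 0 \<le> u e"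
  shows "\<exists>f. is_flow E u s t f \<and> net_flow E f s = max_flow E u s t \<and>
    (\<forall>g. is_flow E u s t g \<longrightarrow> net_flow E g s \<le> max_flow E u s t)"
proof -
  define H where "H = \<lparr>verts = fst ` E \<union> snd ` E, arcs = E, tail = fst, head = snd\<rparr>"
  have H: "finite (arcs H)" "arcs H \<subseteq> verts H \<times> verts H" "tail H = fst" "head H = snd"
    and E: "arcs H = E"
    using assms(1) by (force simp: H_def)+
  have "fin_digraph H" using assms(1) by unfold_locales (auto simp: H_def)
  moreover have u: "0 \<le> u e" if "e \<in> arcs H" for e using assms(2) E that by simp
  ultimately obtain f where f: "st_flow H u s t f" "flow_value H s f = max_flow_value H u s t"
    and g: "\<And>g. st_flow H u s t g \<Longrightarrow> flow_value H s g \<le> max_flow_value H u s t"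
    using max_flow_value_attained[of H u s t] by metis
  have "st_flow H u s t h \<longleftrightarrow> is_flow E u s t h"
    and "flow_value H s h = net_flow E h s" for h
    using st_flow_iff_is_flow[OF H] net_flow_conv[OF H(1,3,4)] E by (simp_all add: flow_value_def)
  with f g max_flow_value_eq_max_flow[OF H] E show ?thesis by auto
qed

lemma max_flow_attained:
  assumes "finite E" and "\<forall>e\<in>E. 0 \<le> u e"
  shows "\<exists>f. is_flow E u s t f \<and> net_flow E f s = max_flow E u s t"
  using max_flow_is_maximum[OF assms] by blast

lemma max_flow_upper:
  assumes "finite E" and "\<forall>e\<in>E. 0 \<le> u e" and "is_flow E u s t f"
  shows "net_flow E f s \<le> max_flow E u s t"
  using max_flow_is_maximum[OF assms(1,2)] assms(3) by blast

lemma is_flow_zero: "(\<forall>e\<in>E. 0 \<le> u e) \<Longrightarrow> is_flow E u s t (\<lambda>_. 0)"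
  by (simp add: is_flow_def net_flow_def)

lemma max_flow_nonneg:
  assumes "finite E" and "\<forall>e\<in>E. 0 \<le> u e"
  shows "0 \<le> max_flow E u s t"
  using max_flow_upper[OF assms is_flow_zero[OF assms(2)]] by (simp add: net_flow_def)

lemma max_flow_mono:
  assumes "finite E" and u: "\<forall>e\<in>E. 0 \<le> u e" and "E' \<subseteq> E"
  shows "max_flow E' u s t \<le> max_flow E u s t"
proof -
  have fin: "finite E'" using assms(1,3) by (rule finite_subset[rotated])
  have u': "\<forall>e\<in>E'. 0 \<le> u e" using assms(2,3) by blast
  obtain f where f: "is_flow E' u s t f" "net_flow E' f s = max_flow E' u s t"
    using max_flow_attained[OF fin u'] by blast
  define g where "g = (\<lambda>e. if e \<in> E' then f e else 0)"
  have net: "net_flow E g v = net_flow E' f v" for v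
    unfolding net_flow_def g_def using assms by (intro sum.mono_neutral_cong_right) auto
  have "is_flow E u s t g"
    using f(1) u by (simp add: is_flow_def net) (simp add: g_def)
  from max_flow_upper[OF assms(1) u this] show ?thesis using f(2) net by simp
qed

section \<open>Graphs glued at a vertex or along a bridge\<close>

lemma inter_loops:
  assumes "E1 \<subseteq> A \<times> A" "E2 \<subseteq> B \<times> B" "A \<inter> B \<subseteq> {c}"
  shows "E1 \<inter> E2 \<subseteq> Id"
  using assms by blast

text \<open>
  A flow between two vertices of \<open>A\<close> is conserved at every vertex of \<open>B\<close> except possibly \<open>c\<close>, hence
  at \<open>c\<close> too as far as the arcs of \<open>E2\<close> are concerned. Dropping these arcs leaves a flow of the
  same value.
\<close>

lemma max_flow_same_side:
  assumes fin: "finite E1" "finite E2" and u: "\<forall>e\<in>E1 \<union> E2. 0 \<le> u e"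
    and sep: "E1 \<subseteq> A \<times> A" "E2 \<subseteq> B \<times> B" "A \<inter> B \<subseteq> {c}" and st: "s \<in> A" "t \<in> A"
  shows "max_flow (E1 \<union> E2) u s t = max_flow E1 u s t"
proof (rule antisym)
  have un: "net_flow (E1 \<union> E2) f v = net_flow E1 f v + net_flow E2 f v" for f v
    by (rule net_flow_Un[OF fin inter_loops[OF sep]])
  obtain f where f: "is_flow (E1 \<union> E2) u s t f"
      "net_flow (E1 \<union> E2) f s = max_flow (E1 \<union> E2) u s t"
    using max_flow_attained[OF finite_UnI[OF fin] u] by blast
  have "net_flow E2 f v = 0" if "v \<noteq> c" for v
  proof (cases "v \<in> B")
    case True
    then have "v \<notin> A" using that sep by auto
    with f st have "net_flow (E1 \<union> E2) f v = 0" by (auto simp: is_flow_def)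
    with un show ?thesis using net_flow_outside[OF sep(1) \<open>v \<notin> A\<close>] by simp
  next
    case False
    then show ?thesis using net_flow_outside[OF sep(2)] by simp
  qed
  then have "net_flow E2 f v = 0" for v using net_flow_zero_of_all_but_one[OF fin(2)] by metis
  then have "net_flow E1 f v = net_flow (E1 \<union> E2) f v" for v using un by simp
  with f have "is_flow E1 u s t f" "net_flow E1 f s = max_flow (E1 \<union> E2) u s t"
    by (auto simp: is_flow_def)
  then show "max_flow (E1 \<union> E2) u s t \<le> max_flow E1 u s t"
    using max_flow_upper[OF fin(1), of u s t f] u by auto
  show "max_flow E1 u s t \<le> max_flow (E1 \<union> E2) u s t"
    using fin u by (intro max_flow_mono) auto
qed

text \<open>
  Everything that leaves \<open>s\<close> has to pass through \<open>c\<close>, so a flow restricts to flows of the same value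
  from \<open>s\<close> to \<open>c\<close> and from \<open>c\<close> to \<open>t\<close>. Conversely, maximum flows of the two parts are scaled down
  to their smaller value, which makes them balance at \<open>c\<close>, and are put together.
\<close>

lemma max_flow_series:
  assumes fin: "finite E1" "finite E2" and u: "\<forall>e\<in>E1 \<union> E2. 0 \<le> u e"
    and sep: "E1 \<subseteq> A \<times> A" "E2 \<subseteq> B \<times> B" "A \<inter> B \<subseteq> {c}"
    and st: "s \<in> A - {c}" "t \<in> B - {c}"
  shows "max_flow (E1 \<union> E2) u s t = min (max_flow E1 u s c) (max_flow E2 u c t)"
proof (rule antisym)
  have un: "net_flow (E1 \<union> E2) f v = net_flow E1 f v + net_flow E2 f v" for f v
    by (rule net_flow_Un[OF fin inter_loops[OF sep]])
  have nt: "s \<notin> B" "t \<notin> A" "s \<noteq> c" "t \<noteq> c" "s \<noteq> t" using sep st by auto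
  have E1_0: "net_flow E1 f v = 0" if "v \<notin> A" for f v by (rule net_flow_outside[OF sep(1) that])
  have E2_0: "net_flow E2 f v = 0" if "v \<notin> B" for f v by (rule net_flow_outside[OF sep(2) that])
  have u1: "\<forall>e\<in>E1. 0 \<le> u e" and u2: "\<forall>e\<in>E2. 0 \<le> u e" using u by auto
  obtain f where f: "is_flow (E1 \<union> E2) u s t f"
      "net_flow (E1 \<union> E2) f s = max_flow (E1 \<union> E2) u s t"
    using max_flow_attained[OF finite_UnI[OF fin] u] by blast
  have f0: "net_flow E1 f v + net_flow E2 f v = 0" if "v \<notin> {s, t}" for v
    using f(1) that un[of f v] by (auto simp: is_flow_def)
  have net1: "net_flow E1 f v = 0" if "v \<notin> {s, c}" for v
  proof (cases "v \<in> A")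
    case True
    then have "v \<notin> B" "v \<noteq> t" using that sep nt by auto
    then show ?thesis using f0[of v] E2_0 that by auto
  qed (rule E1_0)
  have net2: "net_flow E2 f v = 0" if "v \<notin> {c, t}" for v
  proof (cases "v \<in> B")
    case True
    then have "v \<notin> A" "v \<noteq> s" using that sep nt by auto
    then show ?thesis using f0[of v] E1_0 that by auto
  qed (rule E2_0)
  have fl: "is_flow E1 u s c f" "is_flow E2 u c t f"
    using f(1) net1 net2 by (auto simp: is_flow_def)
  have "net_flow E1 f s = max_flow (E1 \<union> E2) u s t"
    using f(2) un E2_0[OF nt(1)] by simp
  moreover have "net_flow E2 f c = net_flow E1 f s"
    using net_flow_source_sink[OF fin(1) nt(3) net1] f0[of c] nt by auto
  ultimately show "max_flow (E1 \<union> E2) u s t \<le> min (max_flow E1 u s c) (max_flow E2 u c t)"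
    using max_flow_upper[OF fin(1) u1 fl(1)] max_flow_upper[OF fin(2) u2 fl(2)] by simp
next
  have un: "net_flow (E1 \<union> E2) f v = net_flow E1 f v + net_flow E2 f v" for f v
    by (rule net_flow_Un[OF fin inter_loops[OF sep]])
  have nt: "s \<notin> B" "t \<notin> A" "s \<noteq> c" "t \<noteq> c" "s \<noteq> t" using sep st by auto
  have u1: "\<forall>e\<in>E1. 0 \<le> u e" and u2: "\<forall>e\<in>E2. 0 \<le> u e" using u by auto
  obtain f1 where f1: "is_flow E1 u s c f1" "net_flow E1 f1 s = max_flow E1 u s c"
    using max_flow_attained[OF fin(1) u1] by blast
  obtain f2 where f2: "is_flow E2 u c t f2" "net_flow E2 f2 c = max_flow E2 u c t"
    using max_flow_attained[OF fin(2) u2] by blast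
  define m1 where "m1 = max_flow E1 u s c"
  define m2 where "m2 = max_flow E2 u c t"
  define m where "m = min m1 m2"
  have m0: "0 \<le> m1" "0 \<le> m2" using max_flow_nonneg fin u1 u2 by (auto simp: m1_def m2_def)
  have r: "0 \<le> m / m1" "m / m1 \<le> 1" "m / m1 * m1 = m" "0 \<le> m / m2" "m / m2 \<le> 1" "m / m2 * m2 = m"
    using m0 by (auto simp: m_def divide_le_eq_1)
  \<comment> \<open>A part of value 0 is scaled by \<open>m / 0 = 0\<close>, as required since then \<open>m = 0\<close>. A loop at \<open>c\<close>
    that lies in both parts may carry either flow.\<close>
  define g where "g = (\<lambda>e. if e \<in> E1 then m / m1 * f1 e else m / m2 * f2 e)"
  have g1: "net_flow E1 g v = m / m1 * net_flow E1 f1 v" for v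
    unfolding net_flow_scale[symmetric] unfolding net_flow_def
    by (intro sum.cong) (auto simp: g_def)
  have g2: "net_flow E2 g v = m / m2 * net_flow E2 f2 v" for v
    unfolding net_flow_scale[symmetric] unfolding net_flow_def
    using inter_loops[OF sep] by (intro sum.cong) (force simp: g_def)+
  have c1: "net_flow E1 f1 c = - m1"
    using net_flow_source_sink[OF fin(1) nt(3), of f1] f1 by (simp add: is_flow_def m1_def)
  have bound: "0 \<le> r * x \<and> r * x \<le> y" if "0 \<le> r" "r \<le> 1" "0 \<le> x" "x \<le> y" for r x y :: real
    using that mult_left_le_one_le[of x r] by auto
  have "is_flow (E1 \<union> E2) u s t g"
    unfolding is_flow_def
  proof (intro conjI ballI allI impI)
    fix e assume e: "e \<in> E1 \<union> E2"
    have "0 \<le> g e \<and> g e \<le> u e"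
      using e f1(1) f2(1) bound[OF r(1,2)] bound[OF r(4,5)]
      unfolding g_def is_flow_def by (cases "e \<in> E1") auto
    then show "0 \<le> g e" "g e \<le> u e" by auto
  next
    fix v assume v: "v \<notin> {s, t}"
    show "net_flow (E1 \<union> E2) g v = 0"
    proof (cases "v = c")
      case True
      then show ?thesis using c1 f2(2) r by (simp add: un g1 g2 m2_def)
    next
      case False
      then show ?thesis using v f1(1) f2(1) by (simp add: un g1 g2 is_flow_def)
    qed
  qed
  moreover have "net_flow (E1 \<union> E2) g s = m"
    using f1(2) r net_flow_outside[OF sep(2) nt(1)] by (simp add: un g1 g2 m1_def)
  ultimately show "min (max_flow E1 u s c) (max_flow E2 u c t) \<le> max_flow (E1 \<union> E2) u s t"
    using max_flow_upper[of "E1 \<union> E2" u s t g] fin u by (auto simp: m_def m1_def m2_def)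
qed

lemma max_flow_disconnected:
  assumes fin: "finite E1" "finite E2" and u: "\<forall>e\<in>E1 \<union> E2. 0 \<le> u e"
    and sep: "E1 \<subseteq> A \<times> A" "E2 \<subseteq> B \<times> B" "A \<inter> B = {}"
    and st: "s \<in> A" "t \<in> B"
  shows "max_flow (E1 \<union> E2) u s t = 0"
proof -
  have AB: "A \<inter> B \<subseteq> {s}" using sep by simp
  have un: "net_flow (E1 \<union> E2) f v = net_flow E1 f v + net_flow E2 f v" for f v
    by (rule net_flow_Un[OF fin inter_loops[OF sep(1,2) AB]])
  obtain f where f: "is_flow (E1 \<union> E2) u s t f"
      "net_flow (E1 \<union> E2) f s = max_flow (E1 \<union> E2) u s t"
    using max_flow_attained[OF finite_UnI[OF fin] u] by blast
  have E2_0: "net_flow E2 f v = 0" if "v \<in> A" for v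
    using net_flow_outside[OF sep(2)] sep(3) that by blast
  have "net_flow E1 f v = 0" if "v \<noteq> s" for v
  proof (cases "v \<in> A")
    case True
    then have "v \<notin> {s, t}" using that sep(3) st by auto
    then show ?thesis using f(1) un[of f v] E2_0[OF True] by (simp add: is_flow_def)
  qed (rule net_flow_outside[OF sep(1)])
  then have "net_flow E1 f s = 0" by (rule net_flow_zero_of_all_but_one[OF fin(1)])
  then show ?thesis using f(2) un[of f s] E2_0[OF st(1)] by simp
qed

text \<open>
  Shrinking one part of the graph and shrinking the other part interact only through the minimum
  in \<open>max_flow_series\<close>, whose supermodularity is the inequality claimed here.
\<close>

lemma max_flow_supermodular_cut_vertex:
  assumes fin: "finite E1" "finite E2" and u: "\<forall>e\<in>E1 \<union> E2. 0 \<le> u e"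
    and sep: "E1 \<subseteq> A \<times> A" "E2 \<subseteq> B \<times> B" "A \<inter> B = {c}"
    and sub: "E1' \<subseteq> E1" "E2' \<subseteq> E2" and st: "s \<in> A \<union> B" "t \<in> A \<union> B"
  shows "max_flow (E1' \<union> E2) u s t - max_flow (E1' \<union> E2') u s t
    \<le> max_flow (E1 \<union> E2) u s t - max_flow (E1 \<union> E2') u s t"
proof -
  have mono: "max_flow E1' u x y \<le> max_flow E1 u x y" "max_flow E2' u x y \<le> max_flow E2 u x y" for x y
    using fin u sub by (auto intro!: max_flow_mono)
  have AB: "A \<inter> B \<subseteq> {c}" and BA: "B \<inter> A \<subseteq> {c}" using sep(3) by auto
  consider (A) "s \<in> A" "t \<in> A" | (B) "s \<in> B" "t \<in> B"
    | (AB) "s \<in> A - {c}" "t \<in> B - {c}" | (BA) "s \<in> B - {c}" "t \<in> A - {c}"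
    using st sep(3) by blast
  then show ?thesis
  proof cases
    case A
    have "max_flow (F1 \<union> F2) u s t = max_flow F1 u s t" if "F1 \<subseteq> E1" "F2 \<subseteq> E2" for F1 F2
      by (rule max_flow_same_side[where A = A and B = B and c = c])
        (use that A u sep AB fin finite_subset in blast)+
    then show ?thesis using sub by simp
  next
    case B
    have "max_flow (F1 \<union> F2) u s t = max_flow F2 u s t" if "F1 \<subseteq> E1" "F2 \<subseteq> E2" for F1 F2
      unfolding Un_commute[of F1]
      by (rule max_flow_same_side[where A = B and B = A and c = c])
        (use that B u sep BA fin finite_subset in blast)+
    then show ?thesis using sub by simp
  next
    case AB
    have "max_flow (F1 \<union> F2) u s t = min (max_flow F1 u s c) (max_flow F2 u c t)"
      if "F1 \<subseteq> E1" "F2 \<subseteq> E2" for F1 F2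
      by (rule max_flow_series[where A = A and B = B])
        (use that AB u sep fin finite_subset in blast)+
    then show ?thesis using sub mono[of s c] mono[of c t] by simp
  next
    case BA
    have "max_flow (F1 \<union> F2) u s t = min (max_flow F2 u s c) (max_flow F1 u c t)"
      if "F1 \<subseteq> E1" "F2 \<subseteq> E2" for F1 F2
      unfolding Un_commute[of F1]
      by (rule max_flow_series[where A = B and B = A])
        (use that BA u sep fin finite_subset in blast)+
    then show ?thesis using sub mono[of s c] mono[of c t] by simp
  qed
qed

text \<open>
  For the two parts joined by a bridge \<open>F\<close>, the bridge is present only as long as neither part has
  been shrunk: shrinking stands for the deletion of \<open>a\<close> or \<open>b\<close>, which takes the bridge with it.
\<close>

lemma max_flow_supermodular_bridge:
  assumes fin: "finite E1" "finite E2" and u: "\<forall>e\<in>E1 \<union> E2 \<union> F. 0 \<le> u e"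
    and sep: "E1 \<subseteq> A \<times> A" "E2 \<subseteq> B \<times> B" "A \<inter> B = {}"
    and F: "F \<subseteq> {(a, b), (b, a)}" "a \<in> A" "b \<in> B"
    and sub: "E1' \<subseteq> E1" "E2' \<subseteq> E2" and st: "s \<in> A \<union> B" "t \<in> A \<union> B"
  shows "max_flow (E1' \<union> E2) u s t - max_flow (E1' \<union> E2') u s t
    \<le> max_flow (E1 \<union> E2 \<union> F) u s t - max_flow (E1 \<union> E2') u s t"
proof -
  have fin': "finite E1'" "finite E2'" "finite F"
    using sub fin F(1) by (auto intro: finite_subset)
  have u': "\<forall>e\<in>E1. 0 \<le> u e" "\<forall>e\<in>E2. 0 \<le> u e" "\<forall>e\<in>F. 0 \<le> u e"
    "\<forall>e\<in>E1'. 0 \<le> u e" "\<forall>e\<in>E2'. 0 \<le> u e"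
    using u sub by auto
  consider (A) "s \<in> A" "t \<in> A" | (B) "s \<in> B" "t \<in> B"
    | (cross) "s \<in> A" "t \<in> B" | (cross') "s \<in> B" "t \<in> A"
    using st by blast
  then show ?thesis
  proof cases
    case A
    \<comment> \<open>The bridge is counted to the side of \<open>b\<close>; the two parts then meet in \<open>a\<close> only.\<close>
    have side: "max_flow (F1 \<union> F2) u s t = max_flow F1 u s t"
      if "F1 \<subseteq> E1" "F2 \<subseteq> E2 \<union> F" for F1 F2
    proof (rule max_flow_same_side[where A = A and B = "insert a B" and c = a])
      show "finite F1" "finite F2" using that fin fin' by (auto intro: finite_subset)
      show "\<forall>e\<in>F1 \<union> F2. 0 \<le> u e" using that u by blast
    qed (use that A sep F in blast)+
    show ?thesis
      using side[of E1' E2] side[of E1' E2'] side[of E1 "E2 \<union> F"] side[of E1 E2'] sub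
        le_supI1[OF sub(2), of F]
      by (simp add: Un_assoc)
  next
    case B
    have side: "max_flow (F1 \<union> F2) u s t = max_flow F1 u s t"
      if "F1 \<subseteq> E2" "F2 \<subseteq> E1 \<union> F" for F1 F2
    proof (rule max_flow_same_side[where A = B and B = "insert b A" and c = b])
      show "finite F1" "finite F2" using that fin fin' by (auto intro: finite_subset)
      show "\<forall>e\<in>F1 \<union> F2. 0 \<le> u e" using that u by blast
    qed (use that B sep F in blast)+
    have "E1 \<union> E2 \<union> F = E2 \<union> (E1 \<union> F)" by blast
    then show ?thesis
      using side[of E2 E1'] side[of E2' E1'] side[of E2 "E1 \<union> F"] side[of E2' E1] sub
        le_supI1[OF sub(1), of F]
      by (simp add: Un_commute)
  next
    case cross
    \<comment> \<open>Without the bridge nothing gets from one side to the other.\<close>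
    have "max_flow (E1' \<union> E2) u s t = 0"
      by (rule max_flow_disconnected[where A = A and B = B])
        (use cross u' sub sep fin fin' in blast)+
    moreover have "0 \<le> max_flow (E1' \<union> E2') u s t"
      using fin' u' by (intro max_flow_nonneg) auto
    moreover have "max_flow (E1 \<union> E2') u s t \<le> max_flow (E1 \<union> E2 \<union> F) u s t"
      using fin fin' u sub by (intro max_flow_mono) auto
    ultimately show ?thesis by simp
  next
    case cross'
    have "max_flow (E2 \<union> E1') u s t = 0"
      by (rule max_flow_disconnected[where A = B and B = A])
        (use cross' u' sub sep fin fin' in blast)+
    moreover have "0 \<le> max_flow (E1' \<union> E2') u s t"
      using fin' u' by (intro max_flow_nonneg) auto
    moreover have "max_flow (E1 \<union> E2') u s t \<le> max_flow (E1 \<union> E2 \<union> F) u s t"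
      using fin fin' u sub by (intro max_flow_mono) auto
    ultimately show ?thesis by (simp add: Un_commute)
  qed
qed

section \<open>Menger's theorem for two paths\<close>

text \<open>
  Paths are taken as vertex lists over an arbitrary relation, because the argument deletes edges and
  vertices of the graph and speaks of paths in what remains.
\<close>

definition simple_walk :: "('a \<times> 'a) set \<Rightarrow> 'a \<Rightarrow> 'a list \<Rightarrow> 'a \<Rightarrow> bool" where
  "simple_walk R a L b \<longleftrightarrow>
     L \<noteq> [] \<and> hd L = a \<and> last L = b \<and> distinct L \<and> set (vwalk_arcs L) \<subseteq> R"

lemma vwalk_arcs_split:
  "set (vwalk_arcs (xs @ y # ys)) = set (vwalk_arcs (xs @ [y])) \<union> set (vwalk_arcs (y # ys))"
  by (cases "xs = []") (auto simp: vwalk_arcs_append)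

lemma simple_walk_exists:
  assumes "(a, b) \<in> R\<^sup>*"
  shows "\<exists>L. simple_walk R a L b"
  using assms
proof (induction rule: rtrancl_induct)
  case base
  have "simple_walk R a [a] a" by (simp add: simple_walk_def)
  then show ?case ..
next
  case (step y z)
  then obtain L where L: "simple_walk R a L y" by blast
  show ?case
  proof (cases "z \<in> set L")
    case True
    then obtain xs ys where xs: "L = xs @ z # ys" by (meson split_list)
    have "simple_walk R a (xs @ [z]) z"
      using L unfolding simple_walk_def xs vwalk_arcs_split[of xs z ys]
      by (auto simp: hd_append)
    then show ?thesis ..
  next
    case False
    have "simple_walk R a (L @ [z]) z"
      using L False step.hyps unfolding simple_walk_def
      by (auto simp: set_vwalk_arcs_snoc)
    then show ?thesis ..
  qed
qed

lemma vwalk_arcs_rtrancl: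
  assumes "set (vwalk_arcs (x # xs)) \<subseteq> R"
  shows "(x, last (x # xs)) \<in> R\<^sup>*"
  using assms
  by (induction xs arbitrary: x) (auto intro: converse_rtrancl_into_rtrancl)

definition avoiding :: "('a \<times> 'a) set \<Rightarrow> 'a \<Rightarrow> ('a \<times> 'a) set" where
  "avoiding R c = {(x, y) \<in> R. x \<noteq> c \<and> y \<noteq> c}"

lemma vwalk_arcs_avoiding:
  "set (vwalk_arcs L) \<subseteq> R \<Longrightarrow> c \<notin> set L \<Longrightarrow> set (vwalk_arcs L) \<subseteq> avoiding R c"
  by (force simp: avoiding_def dest: arcs_in_vwalk_arcs)

lemma vwalk_arcs_avoidingD:
  "set (vwalk_arcs L) \<subseteq> avoiding R c \<Longrightarrow> last L \<noteq> c \<Longrightarrow> L \<noteq> [] \<Longrightarrow>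
     c \<notin> set L \<and> set (vwalk_arcs L) \<subseteq> R"
proof (induction L rule: vwalk_arcs.induct)
  case (3 x y xs)
  then show ?case by (auto simp: avoiding_def)
qed auto

definition doubly_linked :: "('a \<times> 'a) set \<Rightarrow> 'a \<Rightarrow> 'a \<Rightarrow> bool" where
  "doubly_linked R a b \<longleftrightarrow>
     (\<exists>L M. simple_walk R a L b \<and> simple_walk R a M b \<and> L \<noteq> M \<and> set L \<inter> set M = {a, b})"

text \<open>
  One step of the proof of Menger's theorem for two paths. A path from \<open>a\<close> to \<open>x\<close> that avoids \<open>w\<close>
  is followed from its last vertex \<open>y\<close> on one of the two given paths. Switching to it at \<open>y\<close> gives a
  first path to \<open>x\<close>; the other given path, which does not meet it, is prolonged by the edge from
  \<open>w\<close> to \<open>x\<close>.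
\<close>

lemma doubly_linked_extend:
  assumes D: "doubly_linked R a w" and wx: "(w, x) \<in> R" and "x \<noteq> w" "x \<noteq> a" "w \<noteq> a"
    and reach: "(a, x) \<in> (avoiding R w)\<^sup>*"
  shows "doubly_linked R a x"
proof -
  obtain Q where "simple_walk (avoiding R w) a Q x"
    using simple_walk_exists[OF reach] by blast
  with \<open>x \<noteq> w\<close> have Q: "simple_walk R a Q x" and wQ: "w \<notin> set Q"
    unfolding simple_walk_def using vwalk_arcs_avoidingD[of Q R w] by auto
  obtain L M where L: "simple_walk R a L w" and M: "simple_walk R a M w"
    and LM: "set L \<inter> set M = {a, w}"
    using D by (auto simp: doubly_linked_def)
  have "\<exists>z\<in>set Q. z \<in> set L \<union> set M"
    using Q LM unfolding simple_walk_def by (metis IntD1 UnI1 hd_in_set insertI1)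
  then obtain xs y ys where Qs: "Q = xs @ y # ys" and y: "y \<in> set L \<union> set M"
    and ys: "\<forall>z\<in>set ys. z \<notin> set L \<union> set M"
    using split_list_last_prop[of Q "\<lambda>z. z \<in> set L \<union> set M"] by blast
  \<comment> \<open>Stated for arbitrary \<open>L\<close> and \<open>M\<close>, since \<open>y\<close> may lie on either of the two paths.\<close>
  have *: "doubly_linked R a x"
    if L: "simple_walk R a L w" and M: "simple_walk R a M w" and LM: "set L \<inter> set M = {a, w}"
      and y: "y \<in> set L" and ys: "\<forall>z\<in>set ys. z \<notin> set L \<union> set M" for L M
  proof -
    have "y \<noteq> w" using wQ Qs by auto
    obtain cs ds where Ls: "L = cs @ y # ds" using y by (meson split_list)
    have w: "w \<in> set L" "w \<in> set M" using LM by auto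
    have "w \<in> set ds"
      using L \<open>y \<noteq> w\<close> by (auto simp: simple_walk_def Ls split: if_splits)
    then have wc: "w \<notin> set cs" using L by (auto simp: simple_walk_def Ls)
    have xlast: "x = last (y # ys)" using Q by (simp add: simple_walk_def Qs)
    have xM: "x \<notin> set M"
      using xlast ys LM y \<open>x \<noteq> w\<close> \<open>x \<noteq> a\<close> by (cases "ys = []") auto
    define L' where "L' = cs @ y # ys"
    have "distinct L'"
      using L Q ys unfolding simple_walk_def L'_def Ls Qs by auto
    moreover have "hd L' = a"
      using L by (cases cs) (auto simp: simple_walk_def L'_def Ls)
    moreover have "set (vwalk_arcs L') \<subseteq> R"
      using L Q unfolding simple_walk_def L'_def Ls Qs
      by (metis vwalk_arcs_split Un_subset_iff)
    ultimately have L': "simple_walk R a L' x"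
      using xlast by (simp add: simple_walk_def L'_def)
    have M': "simple_walk R a (M @ [x]) x"
      using M xM wx by (auto simp: simple_walk_def set_vwalk_arcs_snoc)
    have wL': "w \<notin> set L'"
      using wc \<open>y \<noteq> w\<close> ys w by (auto simp: L'_def)
    have "a \<in> set L'" "a \<in> set M" "x \<in> set L'"
      using L' LM by (auto simp: simple_walk_def)
    moreover have "set L' \<inter> set M \<subseteq> {a}"
    proof
      fix z assume z: "z \<in> set L' \<inter> set M"
      then have "z \<in> set L" using ys by (auto simp: L'_def Ls)
      then have "z \<in> {a, w}" using z LM by blast
      then show "z \<in> {a}" using z wL' by auto
    qed
    ultimately have "set L' \<inter> set (M @ [x]) = {a, x}" by auto
    moreover have "L' \<noteq> M @ [x]" using wL' w by auto
    ultimately show ?thesis using L' M' unfolding doubly_linked_def by blast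
  qed
  show ?thesis
  proof (cases "y \<in> set L")
    case True
    then show ?thesis using *[OF L M LM] ys by blast
  next
    case False
    then show ?thesis using *[OF M L] LM y ys by blast
  qed
qed

text \<open>
  Along a path from \<open>a\<close> to \<open>b\<close>, let \<open>w\<close> be the last vertex that equals \<open>a\<close> or is doubly linked to
  \<open>a\<close>, and let \<open>x\<close> be its successor. If \<open>w \<noteq> a\<close>, then \<open>w\<close> separates \<open>a\<close> from \<open>x\<close>, since otherwise
  \<open>x\<close> would be doubly linked to \<open>a\<close> by the preceding lemma; and \<open>x\<close> is joined to \<open>b\<close> by the rest of
  the path. If \<open>w = a\<close>, the edge from \<open>a\<close> to \<open>x\<close> is a bridge, since another path from \<open>a\<close> to \<open>x\<close>
  would make \<open>x\<close> doubly linked to \<open>a\<close>. Then either \<open>x = b\<close>, or \<open>x\<close> is a cut vertex.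
\<close>

lemma cut_vertex_or_bridge:
  assumes sym: "sym R" and conn: "(a, b) \<in> R\<^sup>*" and "a \<noteq> b" and nD: "\<not> doubly_linked R a b"
  obtains (cut_vertex) c where "c \<noteq> a" "c \<noteq> b" "(a, b) \<notin> (avoiding R c)\<^sup>*"
  | (bridge) "(a, b) \<notin> (R - {(a, b), (b, a)})\<^sup>*"
proof -
  obtain P where P: "simple_walk R a P b" using simple_walk_exists[OF conn] by blast
  then have "\<exists>v\<in>set P. v = a \<or> doubly_linked R a v"
    unfolding simple_walk_def by (metis hd_in_set)
  then obtain ps w xs where Ps: "P = ps @ w # xs" and w: "w = a \<or> doubly_linked R a w"
    and xs: "\<forall>v\<in>set xs. \<not> (v = a \<or> doubly_linked R a v)"
    using split_list_last_prop[of P "\<lambda>v. v = a \<or> doubly_linked R a v"] by blast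
  have "w \<noteq> b" using w \<open>a \<noteq> b\<close> nD by auto
  then obtain x ys where xs_eq: "xs = x # ys"
    using P by (cases xs) (auto simp: simple_walk_def Ps)
  have arcs: "set (vwalk_arcs (w # x # ys)) \<subseteq> R"
    using P vwalk_arcs_split[of ps w "x # ys"] unfolding simple_walk_def Ps xs_eq by blast
  then have wx: "(w, x) \<in> R" by simp
  have b: "b = last (x # ys)" and wxs: "w \<notin> set (x # ys)"
    using P by (auto simp: simple_walk_def Ps xs_eq)
  have x: "x \<noteq> a" "\<not> doubly_linked R a x" "x \<noteq> w" using xs xs_eq wxs by auto
  have "set (vwalk_arcs (x # ys)) \<subseteq> avoiding R w"
    using arcs wxs by (intro vwalk_arcs_avoiding) auto
  from vwalk_arcs_rtrancl[OF this] have xb: "(x, b) \<in> (avoiding R w)\<^sup>*" using b by simp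
  have "sym (avoiding R w)" using sym by (auto simp: sym_def avoiding_def)
  then have bx: "(b, x) \<in> (avoiding R w)\<^sup>*" using xb by (metis sym_rtrancl symD)
  show thesis
  proof (cases "w = a")
    case False
    have "(a, b) \<notin> (avoiding R w)\<^sup>*"
    proof
      assume "(a, b) \<in> (avoiding R w)\<^sup>*"
      then have "(a, x) \<in> (avoiding R w)\<^sup>*" using bx by (rule rtrancl_trans)
      with w wx x False show False using doubly_linked_extend[of R a w x] by blast
    qed
    with False \<open>w \<noteq> b\<close> show thesis by (rule cut_vertex)
  next
    case True
    let ?R = "R - {(a, x), (x, a)}"
    have noax: "(a, x) \<notin> ?R\<^sup>*"
    proof
      assume "(a, x) \<in> ?R\<^sup>*"
      from simple_walk_exists[OF this] obtain L where L: "simple_walk ?R a L x" ..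
      have M: "simple_walk R a [a, x] x"
        using wx x True by (auto simp: simple_walk_def)
      have "simple_walk R a L x" using L by (auto simp: simple_walk_def)
      moreover have "L \<noteq> [a, x]"
      proof
        assume "L = [a, x]"
        with L show False by (simp add: simple_walk_def)
      qed
      moreover have "a \<in> set L" "x \<in> set L" using L by (auto simp: simple_walk_def)
      then have "set L \<inter> set [a, x] = {a, x}" by auto
      ultimately have "doubly_linked R a x"
        using M unfolding doubly_linked_def by (intro exI[of _ L] exI[of _ "[a, x]"]) simp
      with x show False by blast
    qed
    show thesis
    proof (cases "x = b")
      case True
      then show thesis using noax bridge by simp
    next
      case False
      \<comment> \<open>Going from \<open>a\<close> to \<open>b\<close> around \<open>x\<close> and back to \<open>x\<close> along the path would bypass the bridge.\<close>
      have "(a, b) \<notin> (avoiding R x)\<^sup>*"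
      proof
        assume "(a, b) \<in> (avoiding R x)\<^sup>*"
        moreover have "(avoiding R x)\<^sup>* \<subseteq> ?R\<^sup>*" "(avoiding R w)\<^sup>* \<subseteq> ?R\<^sup>*"
          using True by (auto intro!: rtrancl_mono simp: avoiding_def)
        ultimately have "(a, x) \<in> ?R\<^sup>*" using bx by (meson rtrancl_trans subsetD)
        with noax show False ..
      qed
      with x(1) False show thesis by (rule cut_vertex)
    qed
  qed
qed

lemma pawalk_verts_vwalk_arcs: "L \<noteq> [] \<Longrightarrow> pawalk_verts (hd L) (vwalk_arcs L) = L"
  by (induction L rule: vwalk_arcs.induct) auto

lemma pcas_vwalk_arcs: "L \<noteq> [] \<Longrightarrow> pcas (hd L) (vwalk_arcs L) (last L)"
  by (induction L rule: vwalk_arcs.induct) auto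

lemma simple_walk_imp_undirected_path:
  assumes "simple_walk (parcs (mk_symmetric G)) a L b" and "a \<in> verts G"
  shows "undirected_path G a (vwalk_arcs L) b \<and> pawalk_verts a (vwalk_arcs L) = L"
  using assms pawalk_verts_vwalk_arcs[of L] pcas_vwalk_arcs[of L]
  unfolding undirected_path_def pre_digraph.apath_def pre_digraph.awalk_def simple_walk_def
  by (auto simp: cas_with_proj_eq awalk_verts_with_proj_eq)

lemma doubly_linked_imp_vertex_disjoint_paths:
  assumes "doubly_linked (parcs (mk_symmetric G)) a b" and "a \<in> verts G"
  shows "\<exists>p q. vertex_disjoint_paths G a b p q"
proof -
  obtain L M where LM: "simple_walk (parcs (mk_symmetric G)) a L b"
    "simple_walk (parcs (mk_symmetric G)) a M b" "L \<noteq> M" "set L \<inter> set M = {a, b}"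
    using assms(1) by (auto simp: doubly_linked_def)
  have "vertex_disjoint_paths G a b (vwalk_arcs L) (vwalk_arcs M)"
    using LM simple_walk_imp_undirected_path[OF LM(1) assms(2)]
      simple_walk_imp_undirected_path[OF LM(2) assms(2)]
    unfolding vertex_disjoint_paths_def by metis
  then show ?thesis by blast
qed

section \<open>Deleting vertices\<close>

definition arcs_avoiding :: "('a \<times> 'a) set \<Rightarrow> 'a set \<Rightarrow> ('a \<times> 'a) set" where
  "arcs_avoiding E X = {e \<in> E. fst e \<notin> X \<and> snd e \<notin> X}"

text \<open>
  The separation is found in the relation \<open>R\<close> and then applied to the smaller arc set \<open>E\<close>: for \<open>R\<close>
  the adjacency of the whole graph, this covers every graph obtained from it by deletions.
\<close>

lemma flow_loss_mono:
  assumes fin: "finite E" and u: "\<forall>e\<in>E. 0 \<le> u e" and "sym R" "E \<subseteq> R"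
    and "(i, k) \<in> R\<^sup>*" "i \<noteq> k" "\<not> doubly_linked R i k"
  shows "max_flow (arcs_avoiding E {i}) u s t - max_flow (arcs_avoiding E {i, k}) u s t
    \<le> max_flow E u s t - max_flow (arcs_avoiding E {k}) u s t"
  using \<open>sym R\<close> assms(5-7)
proof (cases rule: cut_vertex_or_bridge)
  case (cut_vertex c)
  define C where "C = {v. (i, v) \<in> (avoiding R c)\<^sup>*}"
  \<comment> \<open>The vertex \<open>c\<close> belongs to both sides, so that each arc lies within one of them.\<close>
  define A where "A = insert c C"
  define B where "B = insert c (- C)"
  have "c \<notin> C"
  proof
    assume "c \<in> C"
    then show False using cut_vertex(1) unfolding C_def
      by (auto elim: rtranclE simp: avoiding_def)
  qed
  then have AB: "A \<inter> B = {c}" by (auto simp: A_def B_def)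
  have i: "i \<in> C" and k: "k \<notin> C" using cut_vertex(3) by (auto simp: C_def)
  have closed: "x \<in> C \<longleftrightarrow> y \<in> C" if xy: "(x, y) \<in> R" "x \<noteq> c" "y \<noteq> c" for x y
  proof -
    have "(x, y) \<in> avoiding R c" "(y, x) \<in> avoiding R c"
      using xy \<open>sym R\<close> by (auto simp: avoiding_def dest: symD)
    then show ?thesis unfolding C_def by (auto intro: rtrancl_into_rtrancl)
  qed
  have E: "E \<subseteq> A \<times> A \<union> B \<times> B"
  proof
    fix e assume "e \<in> E"
    then show "e \<in> A \<times> A \<union> B \<times> B"
      using closed[of "fst e" "snd e"] \<open>E \<subseteq> R\<close>
      by (cases e) (auto simp: A_def B_def)
  qed
  define E1 where "E1 = E \<inter> A \<times> A"
  define E2 where "E2 = E \<inter> B \<times> B"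
  have eqs: "E = E1 \<union> E2"
    "arcs_avoiding E {i} = arcs_avoiding E1 {i} \<union> E2"
    "arcs_avoiding E {k} = E1 \<union> arcs_avoiding E2 {k}"
    "arcs_avoiding E {i, k} = arcs_avoiding E1 {i} \<union> arcs_avoiding E2 {k}"
    using E i k cut_vertex(1,2) \<open>c \<notin> C\<close>
    unfolding E1_def E2_def A_def B_def arcs_avoiding_def by auto
  have "max_flow (arcs_avoiding E1 {i} \<union> E2) u s t
        - max_flow (arcs_avoiding E1 {i} \<union> arcs_avoiding E2 {k}) u s t
      \<le> max_flow (E1 \<union> E2) u s t - max_flow (E1 \<union> arcs_avoiding E2 {k}) u s t"
  proof (rule max_flow_supermodular_cut_vertex[where A = A and B = B and c = c])
    show "finite E1" "finite E2" using fin by (auto simp: E1_def E2_def)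
    show "\<forall>e\<in>E1 \<union> E2. 0 \<le> u e" using u by (auto simp: E1_def E2_def)
    show "s \<in> A \<union> B" "t \<in> A \<union> B" by (auto simp: A_def B_def)
  qed (use AB in \<open>auto simp: E1_def E2_def arcs_avoiding_def\<close>)
  then show ?thesis using eqs by simp
next
  case bridge
  define R' where "R' = R - {(i, k), (k, i)}"
  define A where "A = {v. (i, v) \<in> R'\<^sup>*}"
  have i: "i \<in> A" and k: "k \<in> - A" using bridge by (auto simp: A_def R'_def)
  have closed: "x \<in> A \<longleftrightarrow> y \<in> A" if xy: "(x, y) \<in> R'" for x y
  proof -
    have "(y, x) \<in> R'" using xy \<open>sym R\<close> by (auto simp: R'_def dest: symD)
    with xy show ?thesis unfolding A_def by (auto intro: rtrancl_into_rtrancl)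
  qed
  define E1 where "E1 = E \<inter> A \<times> A"
  define E2 where "E2 = E \<inter> (- A) \<times> (- A)"
  define F where "F = E \<inter> {(i, k), (k, i)}"
  have E: "E = E1 \<union> E2 \<union> F"
  proof -
    have "e \<in> E1 \<union> E2 \<union> F" if "e \<in> E" for e
      using closed[of "fst e" "snd e"] \<open>E \<subseteq> R\<close> that
      by (cases e) (auto simp: E1_def E2_def F_def R'_def)
    then show ?thesis by (auto simp: E1_def E2_def F_def)
  qed
  have eqs:
    "arcs_avoiding E {i} = arcs_avoiding E1 {i} \<union> E2"
    "arcs_avoiding E {k} = E1 \<union> arcs_avoiding E2 {k}"
    "arcs_avoiding E {i, k} = arcs_avoiding E1 {i} \<union> arcs_avoiding E2 {k}"
    using i k unfolding E arcs_avoiding_def by (auto simp: E1_def E2_def F_def)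
  have "max_flow (arcs_avoiding E1 {i} \<union> E2) u s t
        - max_flow (arcs_avoiding E1 {i} \<union> arcs_avoiding E2 {k}) u s t
      \<le> max_flow (E1 \<union> E2 \<union> F) u s t - max_flow (E1 \<union> arcs_avoiding E2 {k}) u s t"
  proof (rule max_flow_supermodular_bridge[where A = A and B = "- A" and a = i and b = k])
    show "finite E1" "finite E2" using fin by (auto simp: E1_def E2_def)
    show "\<forall>e\<in>E1 \<union> E2 \<union> F. 0 \<le> u e" using u by (auto simp: E1_def E2_def F_def)
  qed (use i k in \<open>auto simp: E1_def E2_def F_def arcs_avoiding_def\<close>)
  then show ?thesis using eqs E by simp
qed

text \<open>
  Since \<open>k\<close> is excluded from the pairs in the flow capacity, both capacities in the vitality range
  over the same pairs and their difference can be taken term by term.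
\<close>

lemma all_pairs_vitality_delete_verts:
  assumes G: "pair_fin_digraph G" and k: "k \<notin> X"
  shows "all_pairs_vitality (delete_verts (with_proj G) X) u k =
    (\<Sum>(s, t)\<in>{(s, t). s \<in> pverts G - insert k X \<and> t \<in> pverts G - insert k X \<and> s \<noteq> t}.
      max_flow (arcs_avoiding (parcs G) X) u s t
      - max_flow (arcs_avoiding (parcs G) (insert k X)) u s t)"
proof -
  interpret pair_fin_digraph G by (rule G)
  have arcs: "arcs (delete_verts (with_proj G) Y) = arcs_avoiding (parcs G) Y" for Y
    using in_arcsD1 in_arcsD2
    by (auto simp: delete_verts_def arcs_avoiding_def)
  have mf: "max_flow_value (delete_verts (with_proj G) Y) u s t
      = max_flow (arcs_avoiding (parcs G) Y) u s t" for Y s t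
    unfolding arcs[symmetric]
  proof (rule max_flow_value_eq_max_flow)
    show "finite (arcs (delete_verts (with_proj G) Y))"
      using pair_finite_arcs by (simp add: arcs arcs_avoiding_def)
    show "arcs (delete_verts (with_proj G) Y)
        \<subseteq> verts (delete_verts (with_proj G) Y) \<times> verts (delete_verts (with_proj G) Y)"
      by (auto simp: delete_verts_def)
  qed (simp_all add: delete_verts_def)
  have twice: "delete_verts (delete_verts (with_proj G) X) {k}
      = delete_verts (with_proj G) (insert k X)"
    by (auto simp: delete_verts_def induce_subgraph_def)
  have "{(s, t). s \<in> verts (delete_verts (with_proj G) X) - {k} \<and>
        t \<in> verts (delete_verts (with_proj G) X) - {k} \<and> s \<noteq> t}
      = {(s, t). s \<in> pverts G - insert k X \<and> t \<in> pverts G - insert k X \<and> s \<noteq> t}"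
    "{(s, t). s \<in> verts (delete_verts (with_proj G) (insert k X)) - {k} \<and>
        t \<in> verts (delete_verts (with_proj G) (insert k X)) - {k} \<and> s \<noteq> t}
      = {(s, t). s \<in> pverts G - insert k X \<and> t \<in> pverts G - insert k X \<and> s \<noteq> t}"
    by (auto simp: delete_verts_def)
  then show ?thesis
    unfolding all_pairs_vitality_def twice flow_capacity_def mf
    by (simp add: sum_subtractf case_prod_unfold)
qed

theorem theorem2:
  fixes G :: "'a pair_pre_digraph" and u :: "'a \<times> 'a \<Rightarrow> real"
    and i k :: 'a and S T :: "'a set"
  assumes "pair_fin_digraph G" and "connected (with_proj G)"
    and "\<And>e. e \<in> parcs G \<Longrightarrow> 0 \<le> u e"
    and "k \<in> pverts G" and "i \<in> pverts G - {k}"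
    and "\<not> (\<exists>p q. vertex_disjoint_paths (with_proj G) i k p q)"
    and "S \<subseteq> pverts G - {k}" and "i \<in> S" and "T = S - {i}"
  shows "all_pairs_vitality (delete_verts (with_proj G) S) u k
           \<le> all_pairs_vitality (delete_verts (with_proj G) T) u k
       \<and> vitality_effect (with_proj G) u k S \<le> vitality_effect (with_proj G) u k T"
proof -
  interpret pair_fin_digraph G by fact
  define E where "E = arcs_avoiding (parcs G) T"
  define R where "R = parcs (mk_symmetric (with_proj G))"
  have fin: "finite E" using pair_finite_arcs by (simp add: E_def arcs_avoiding_def)
  have u: "\<forall>e\<in>E. 0 \<le> u e" using assms(3) by (simp add: E_def arcs_avoiding_def)
  have "sym R"
    using symmetric_mk_symmetric[of "with_proj G"] by (simp add: R_def symmetric_def)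
  have "E \<subseteq> R" by (force simp: E_def R_def arcs_avoiding_def parcs_mk_symmetric)
  have "i \<noteq> k" using assms(5) by simp
  have "(i, k) \<in> rtrancl_on (pverts G) R"
    using assms(2,4,5)
    unfolding connected_def strongly_connected_def reachable_def R_def by auto
  then have "(i, k) \<in> R\<^sup>*" by (rule rtrancl_on_rtranclI)
  have "\<not> doubly_linked R i k"
    using doubly_linked_imp_vertex_disjoint_paths[of "with_proj G" i k] assms(5,6)
    by (auto simp: R_def)
  let ?P = "\<lambda>X. {(s, t). s \<in> pverts G - insert k X \<and> t \<in> pverts G - insert k X \<and> s \<noteq> t}"
  let ?loss = "\<lambda>X s t. max_flow (arcs_avoiding (parcs G) X) u s t
      - max_flow (arcs_avoiding (parcs G) (insert k X)) u s t"
  have S: "arcs_avoiding (parcs G) S = arcs_avoiding E {i}"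
    "arcs_avoiding (parcs G) (insert k S) = arcs_avoiding E {i, k}"
    "arcs_avoiding (parcs G) (insert k T) = arcs_avoiding E {k}"
    using assms(8,9) by (auto simp: E_def arcs_avoiding_def)
  have loss: "?loss S s t \<le> ?loss T s t" for s t
    using flow_loss_mono[OF fin u \<open>sym R\<close> \<open>E \<subseteq> R\<close> \<open>(i, k) \<in> R\<^sup>*\<close> \<open>i \<noteq> k\<close>
        \<open>\<not> doubly_linked R i k\<close>, of s t]
    by (simp only: S flip: E_def)
  have "arcs_avoiding E {k} \<subseteq> E" by (auto simp: arcs_avoiding_def)
  then have loss_nonneg: "0 \<le> ?loss T s t" for s t
    using max_flow_mono[OF fin u, of "arcs_avoiding E {k}" s t] by (simp add: S flip: E_def)
  have finP: "finite (?P T)"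
    using pair_finite_verts by (auto intro: finite_subset[of _ "pverts G \<times> pverts G"])
  have k: "k \<notin> S" "k \<notin> T" using assms(7,9) by auto
  have "all_pairs_vitality (delete_verts (with_proj G) S) u k = (\<Sum>(s, t)\<in>?P S. ?loss S s t)"
    by (rule all_pairs_vitality_delete_verts[OF assms(1) k(1)])
  also have "\<dots> \<le> (\<Sum>(s, t)\<in>?P S. ?loss T s t)"
    using loss by (intro sum_mono) auto
  also have "\<dots> \<le> (\<Sum>(s, t)\<in>?P T. ?loss T s t)"
    using loss_nonneg finP assms(9) by (intro sum_mono2) auto
  also have "\<dots> = all_pairs_vitality (delete_verts (with_proj G) T) u k"
    by (rule all_pairs_vitality_delete_verts[OF assms(1) k(2), symmetric])
  finally show ?thesis by (simp add: vitality_effect_def)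
qed

end
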